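(* Let $\lambda_0>0$, $\epsilon\ge0$, let $\bm{M}_0^\star$ be the optimal solution of $\min_{\bm{M}\succeq\bm{O}}P_{\lambda_0}(\bm{M})$, and let $\bm{M}_0$ be an approximate solution for $\lambda_0$ with $\|\bm{M}_0^\star-\bm{M}_0\|_F\le\epsilon$. Let $(i,j,l)\in\mathcal{T}$ be a triplet such that $$\langle \bm{H}_{ijl},\bm{M}_0\rangle-2+\|\bm{H}_{ijl}\|_F\|\bm{M}_0\|_F>0.$$ Then $(i,j,l)$ is guaranteed to be in $\mathcal{R}^\star$ (that is, $\langle\bm{H}_{ijl},\bm{M}^\star\rangle>1$ for the optimal solution $\bm{M}^\star$ for $\lambda$) for every $\lambda\in(\lambda_a,\lambda_b)$, where $$\lambda_a=\frac{\lambda_0\left(\|\bm{M}_0\|_F\|\bm{H}_{ijl}\|_F-\langle \bm{H}_{ijl},\bm{M}_0\rangle+2\epsilon\|\bm{H}_{ijl}\|_F\right)}{\langle \bm{H}_{ijl},\bm{M}_0\rangle-2+\|\bm{H}_{ijl}\|_F\|\bm{M}_0\|_F},$$ $$\lambda_b=\frac{\lambda_0\left(\|\bm{M}_0\|_F\|\bm{H}_{ijl}\|_F+\langle \bm{H}_{ijl},\bm{M}_0\rangle\right)}{\|\bm{H}_{ijl}\|_F\|\bm{M}_0\|_F-\langle \bm{H}_{ijl},\bm{M}_0\rangle+2+2\epsilon\|\bm{H}_{ijl}\|_F}.$$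
   Context: Let $\bm{x}_1,\dots,\bm{x}_n\in\mathbb{R}^d$ have labels $y_1,\dots,y_n$ in a discrete set, and let $\mathcal{T}=\{(i,j,l)\in\{1,\dots,n\}^3\mid y_i=y_j,\ i\neq j,\ y_i\neq y_l\}$. For $(i,j,l)\in\mathcal{T}$ put $\bm{H}_{ijl}=(\bm{x}_i-\bm{x}_l)(\bm{x}_i-\bm{x}_l)^\top-(\bm{x}_i-\bm{x}_j)(\bm{x}_i-\bm{x}_j)^\top$. $\langle \bm{A},\bm{B}\rangle=\mathrm{tr}(\bm{A}^\top\bm{B})$, $\|\bm{A}\|_F^2=\langle\bm{A},\bm{A}\rangle$, and $\bm{M}\succeq\bm{O}$ means that $\bm{M}\in\mathbb{R}^{d\times d}$ is (symmetric) positive semi-definite. The loss $\ell:\mathbb{R}\to\mathbb{R}$ is either the hinge loss $\ell(x)=\max\{0,1-x\}$ (parameter $\gamma=0$), or, for a parameter $\gamma>0$, the smoothed hinge loss: $\ell(x)=0$ for $x>1$, $\ell(x)=\frac{1}{2\gamma}(1-x)^2$ for $1-\gamma\le x\le1$, $\ell(x)=1-x-\frac{\gamma}{2}$ for $x<1-\gamma$. For $\lambda>0$ the primal objective is $P_\lambda(\bm{M})=\sum_{(i,j,l)\in\mathcal{T}}\ell(\langle\bm{M},\bm{H}_{ijl}\rangle)+\frac{\lambda}{2}\|\bm{M}\|_F^2$, with optimal solution $\bm{M}^\star$ over $\bm{M}\succeq\bm{O}$ (depending on $\lambda$), and $\mathcal{R}^\star=\{(i,j,l)\in\mathcal{T}\mid\langle\bm{H}_{ijl},\bm{M}^\star\rangle>1\}$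 (also depending on $\lambda$). The interval $(\lambda_a,\lambda_b)$ is understood as $\{\lambda\mid\lambda_a<\lambda<\lambda_b\}$, possibly empty. *)

theory Defs
  imports "HOL-Analysis.Analysis"
begin

definition mat_ip :: "real^'d^'d \<Rightarrow> real^'d^'d \<Rightarrow> real" where
  "mat_ip A B = trace (transpose A ** B)"

definition fro_norm :: "real^'d^'d \<Rightarrow> real" where
  "fro_norm A = sqrt (mat_ip A A)"

text \<open>These coincide with the inner product and norm of the type \<^typ>\<open>real^'d^'d\<close>.\<close>

lemma mat_ip_eq_inner: "mat_ip A B = A \<bullet> B"
  unfolding mat_ip_def trace_def transpose_def matrix_matrix_mult_def inner_vec_def
  by (simp, rule sum.swap)

lemma fro_norm_eq_norm: "fro_norm A = norm A"
  by (simp add: fro_norm_def mat_ip_eq_inner norm_eq_sqrt_inner)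

definition psd :: "real^'d^'d \<Rightarrow> bool" where
  "psd M \<longleftrightarrow> transpose M = M \<and> (\<forall>v. 0 \<le> v \<bullet> (M *v v))"

definition outer_square :: "real^'d \<Rightarrow> real^'d^'d" where
  "outer_square v = (\<chi> i j. v $ i * v $ j)"

text \<open>Samples and labels are indexed by \<open>1, \<dots>, n\<close>; values of \<open>x\<close> and \<open>y\<close> at other
  indices play no role.\<close>

definition triplets :: "nat \<Rightarrow> (nat \<Rightarrow> 'c) \<Rightarrow> (nat \<times> nat \<times> nat) set" where
  "triplets n y = {(i, j, l). i \<in> {1..n} \<and> j \<in> {1..n} \<and> l \<in> {1..n} \<and>
     y i = y j \<and> i \<noteq> j \<and> y i \<noteq> y l}"

definition triplet_mat :: "(nat \<Rightarrow> real^'d) \<Rightarrow> nat \<times> nat \<times> nat \<Rightarrow> real^'d^'d" where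
  "triplet_mat x = (\<lambda>(i, j, l). outer_square (x i - x l) - outer_square (x i - x j))"

definition hinge_loss :: "real \<Rightarrow> real" where
  "hinge_loss t = max 0 (1 - t)"

definition smoothed_hinge_loss :: "real \<Rightarrow> real \<Rightarrow> real" where
  "smoothed_hinge_loss \<gamma> t =
    (if t > 1 then 0
     else if 1 - \<gamma> \<le> t then (1 - t)^2 / (2 * \<gamma>)
     else 1 - t - \<gamma> / 2)"

text \<open>Only used for \<open>\<gamma> \<ge> 0\<close>; the parameter value \<open>\<gamma> = 0\<close> selects the plain hinge loss.\<close>

definition loss :: "real \<Rightarrow> real \<Rightarrow> real" where
  "loss \<gamma> = (if \<gamma> = 0 then hinge_loss else smoothed_hinge_loss \<gamma>)"

definition primal ::
  "nat \<Rightarrow> (nat \<Rightarrow> real^'d) \<Rightarrow> (nat \<Rightarrow> 'c) \<Rightarrow> real \<Rightarrow> real \<Rightarrow> real^'d^'d \<Rightarrow> real" where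
  "primal n x y \<gamma> lam M =
    (\<Sum>t\<in>triplets n y. loss \<gamma> (mat_ip M (triplet_mat x t))) + lam / 2 * (fro_norm M)^2"

text \<open>For \<open>lam > 0\<close> the objective is strictly convex and coercive, so the minimiser over the
  positive semi-definite matrices exists and is unique.\<close>

definition optimal_solution ::
  "nat \<Rightarrow> (nat \<Rightarrow> real^'d) \<Rightarrow> (nat \<Rightarrow> 'c) \<Rightarrow> real \<Rightarrow> real \<Rightarrow> real^'d^'d \<Rightarrow> bool" where
  "optimal_solution n x y \<gamma> lam M \<longleftrightarrow> is_arg_min (primal n x y \<gamma> lam) psd M"

text \<open>The set \<open>\<R>\<^sup>\<star>\<close> is obtained by taking \<open>M\<close> to be the optimal solution for \<open>lam\<close>.\<close>

definition R_set ::
  "nat \<Rightarrow> (nat \<Rightarrow> real^'d) \<Rightarrow> (nat \<Rightarrow> 'c) \<Rightarrow> real^'d^'d \<Rightarrow> (nat \<times> nat \<times> nat) set" where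
  "R_set n x y M = {t \<in> triplets n y. mat_ip (triplet_mat x t) M > 1}"

definition lambda_a :: "real \<Rightarrow> real \<Rightarrow> real^'d^'d \<Rightarrow> real^'d^'d \<Rightarrow> real" where
  "lambda_a lam0 \<epsilon> M0 H =
    lam0 * (fro_norm M0 * fro_norm H - mat_ip H M0 + 2 * \<epsilon> * fro_norm H) /
    (mat_ip H M0 - 2 + fro_norm H * fro_norm M0)"

definition lambda_b :: "real \<Rightarrow> real \<Rightarrow> real^'d^'d \<Rightarrow> real^'d^'d \<Rightarrow> real" where
  "lambda_b lam0 \<epsilon> M0 H =
    lam0 * (fro_norm M0 * fro_norm H + mat_ip H M0) /
    (fro_norm H * fro_norm M0 - mat_ip H M0 + 2 + 2 * \<epsilon> * fro_norm H)"

end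

(* Adding the variational inequalities of the optimal solutions M0* and M* (for lam0 and lam)
   cancels the loss term and puts M* in the ball with centre (lam0 + lam) / (2 lam) M0* and
   radius |lam0 - lam| / (2 lam) |M0*|.  Minimising the linear functional H over this ball, and
   replacing M0* by M0 at the cost of epsilon, bounds <H, M*> from below; the bound exceeds 1
   for lam \<le> lam0 exactly when lam > lambda_a, and for lam \<ge> lam0 exactly when lam < lambda_b. *)
theory Submission
  imports Defs
begin

section \<open>Convexity of the losses and of the feasible cone\<close>

text \<open>Together with \<open>loss_attained\<close>, this expresses both losses uniformly as a maximum of
  affine functions, which makes their convexity immediate.\<close>

lemma loss_ge_affine:
  assumes "\<gamma> \<ge> 0" "0 \<le> s" "s \<le> 1"
  shows "s * (1 - t) - \<gamma> / 2 * s^2 \<le> loss \<gamma> t"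
proof (cases "\<gamma> = 0")
  case True
  have "s * (1 - t) \<le> max 0 (1 - t)"
    using assms mult_left_le_one_le[of "1 - t" s] by (cases "t \<le> 1") (auto simp: mult_nonneg_nonpos)
  then show ?thesis
    using True by (simp add: loss_def hinge_loss_def)
next
  case False
  then have \<gamma>: "\<gamma> > 0" using assms by simp
  consider "t > 1" | "t \<le> 1" "1 - \<gamma> \<le> t" | "t \<le> 1" "t < 1 - \<gamma>"
    by linarith
  then show ?thesis
  proof cases
    case 1
    have "s * (1 - t) \<le> 0"
      using 1 assms by (simp add: mult_nonneg_nonpos)
    moreover have "0 \<le> \<gamma> / 2 * s^2"
      using \<gamma> by simp
    ultimately show ?thesis
      using 1 False by (simp add: loss_def smoothed_hinge_loss_def)
  next
    case 2
    \<comment> \<open>Completing the square in \<open>s\<close>: equality holds at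
      \<open>s = (1 - t) / \<gamma>\<close>.\<close>
    have "0 \<le> (1 - t - \<gamma> * s)^2"
      by simp
    then have "(s * (1 - t) - \<gamma> / 2 * s^2) * (2 * \<gamma>) \<le> (1 - t)^2"
      by (simp add: power2_eq_square algebra_simps)
    then have "s * (1 - t) - \<gamma> / 2 * s^2 \<le> (1 - t)^2 / (2 * \<gamma>)"
      using \<gamma> by (simp add: pos_le_divide_eq)
    then show ?thesis
      using 2 False by (simp add: loss_def smoothed_hinge_loss_def)
  next
    case 3
    \<comment> \<open>The gap between the two sides of the claim is exactly the sum of this product
      and the square term below.\<close>
    have "0 \<le> (1 - s) * (1 - t - \<gamma>)"
      using 3 assms by simp
    moreover have "0 \<le> \<gamma> / 2 * (1 - s)^2"
      using \<gamma> by simp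
    ultimately have "s * (1 - t) - \<gamma> / 2 * s^2 \<le> 1 - t - \<gamma> / 2"
      by (simp add: power2_eq_square field_simps)
    then show ?thesis
      using 3 False by (simp add: loss_def smoothed_hinge_loss_def)
  qed
qed

text \<open>The maximiser \<open>s\<close> is minus a slope of the loss at \<open>t\<close>: 0 on
  the flat part, 1 on the linear part, and \<open>(1 - t) / \<gamma>\<close> on the quadratic
  part.\<close>

lemma loss_attained:
  assumes "\<gamma> \<ge> 0"
  obtains s where "0 \<le> s" "s \<le> 1" "loss \<gamma> t = s * (1 - t) - \<gamma> / 2 * s^2"
proof (cases "t > 1")
  case True
  then show ?thesis
    using that[of 0] by (simp add: loss_def hinge_loss_def smoothed_hinge_loss_def)
next
  case t: False
  show ?thesis
  proof (cases "\<gamma> = 0 \<or> t < 1 - \<gamma>")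
    case True
    then show ?thesis
      using that[of 1] t by (auto simp: loss_def hinge_loss_def smoothed_hinge_loss_def)
  next
    case False
    then have \<gamma>: "\<gamma> > 0" "1 - \<gamma> \<le> t"
      using assms by auto
    have "0 \<le> (1 - t) / \<gamma>" "(1 - t) / \<gamma> \<le> 1"
      using \<gamma> t by (simp_all add: divide_le_eq)
    moreover have "(1 - t) / \<gamma> * (1 - t) - \<gamma> / 2 * ((1 - t) / \<gamma>)^2 = (1 - t)^2 / (2 * \<gamma>)"
      using \<gamma>(1) by (simp add: power2_eq_square)
    ultimately show ?thesis
      using that[of "(1 - t) / \<gamma>"] t \<gamma> by (simp add: loss_def smoothed_hinge_loss_def)
  qed
qed

lemma convex_on_loss:
  assumes "\<gamma> \<ge> 0"
  shows "convex_on UNIV (loss \<gamma>)"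
proof (rule convex_onI)
  fix u a b :: real
  assume u: "0 < u" "u < 1"
  \<comment> \<open>The affine function that attains the loss at the intermediate point lies below
    the loss at both endpoints.\<close>
  obtain s where s: "0 \<le> s" "s \<le> 1"
    "loss \<gamma> ((1 - u) *\<^sub>R a + u *\<^sub>R b) =
       s * (1 - ((1 - u) *\<^sub>R a + u *\<^sub>R b)) - \<gamma> / 2 * s^2"
    by (rule loss_attained[OF assms])
  have "loss \<gamma> ((1 - u) *\<^sub>R a + u *\<^sub>R b) =
      (1 - u) * (s * (1 - a) - \<gamma> / 2 * s^2) + u * (s * (1 - b) - \<gamma> / 2 * s^2)"
    unfolding s(3) by (simp add: field_simps)
  also have "\<dots> \<le> (1 - u) * loss \<gamma> a + u * loss \<gamma> b"
    using u s assms by (intro add_mono mult_left_mono loss_ge_affine) auto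
  finally show "loss \<gamma> ((1 - u) *\<^sub>R a + u *\<^sub>R b) \<le> (1 - u) * loss \<gamma> a + u * loss \<gamma> b" .
qed simp

lemma convex_on_sum_loss:
  fixes H :: "'i \<Rightarrow> real^'d^'d"
  assumes "\<gamma> \<ge> 0"
  shows "convex_on UNIV (\<lambda>M. \<Sum>t\<in>T. loss \<gamma> (mat_ip M (H t)))"
proof (rule convex_onI)
  fix u :: real and A B :: "real^'d^'d"
  assume u: "0 < u" "u < 1"
  have "loss \<gamma> (mat_ip ((1 - u) *\<^sub>R A + u *\<^sub>R B) (H t)) \<le>
      (1 - u) * loss \<gamma> (mat_ip A (H t)) + u * loss \<gamma> (mat_ip B (H t))" for t
  proof -
    have "mat_ip ((1 - u) *\<^sub>R A + u *\<^sub>R B) (H t) =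
        (1 - u) *\<^sub>R mat_ip A (H t) + u *\<^sub>R mat_ip B (H t)"
      by (simp add: mat_ip_eq_inner inner_add_left)
    then show ?thesis
      using convex_onD[OF convex_on_loss[OF assms], of u "mat_ip A (H t)" "mat_ip B (H t)"] u
      by simp
  qed
  then have "(\<Sum>t\<in>T. loss \<gamma> (mat_ip ((1 - u) *\<^sub>R A + u *\<^sub>R B) (H t))) \<le>
      (\<Sum>t\<in>T. (1 - u) * loss \<gamma> (mat_ip A (H t)) + u * loss \<gamma> (mat_ip B (H t)))"
    by (rule sum_mono)
  then show "(\<Sum>t\<in>T. loss \<gamma> (mat_ip ((1 - u) *\<^sub>R A + u *\<^sub>R B) (H t))) \<le>
      (1 - u) * (\<Sum>t\<in>T. loss \<gamma> (mat_ip A (H t))) + u * (\<Sum>t\<in>T. loss \<gamma> (mat_ip B (H t)))"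
    by (simp only: sum.distrib sum_distrib_left)
qed simp

lemma convex_psd: "convex {M. psd M}"
proof (rule convexI)
  fix A B :: "real^'d^'d" and u v :: real
  assume "A \<in> {M. psd M}" "B \<in> {M. psd M}" and uv: "0 \<le> u" "0 \<le> v"
  then have A: "transpose A = A" "\<And>w. 0 \<le> w \<bullet> (A *v w)"
    and B: "transpose B = B" "\<And>w. 0 \<le> w \<bullet> (B *v w)"
    by (auto simp: psd_def)
  have "transpose (u *\<^sub>R A + v *\<^sub>R B) = u *\<^sub>R transpose A + v *\<^sub>R transpose B"
    by (simp add: transpose_def vec_eq_iff)
  moreover have "0 \<le> w \<bullet> ((u *\<^sub>R A + v *\<^sub>R B) *v w)" for w
    using uv A(2)[of w] B(2)[of w]
    by (simp add: matrix_vector_mult_add_rdistrib scaleR_matrix_vector_assoc[symmetric]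
        inner_add_right)
  ultimately show "u *\<^sub>R A + v *\<^sub>R B \<in> {M. psd M}"
    using A(1) B(1) by (simp add: psd_def)
qed

section \<open>Variational inequality and the ball containing the second minimiser\<close>

text \<open>First-order optimality of \<open>a\<close> in the direction \<open>b - a\<close>, for
  \<open>f\<close> merely convex, so that the kink of the hinge loss needs no subgradients. Along
  the segment from \<open>a\<close> to \<open>b\<close>, \<open>f\<close> is bounded by its chord
  and only the quadratic term is expanded.\<close>

lemma regularized_minimizer_variational:
  fixes f :: "'a::real_inner \<Rightarrow> real"
  assumes f: "convex_on S f" and "a \<in> S" "b \<in> S"
    and min: "\<And>z. z \<in> S \<Longrightarrow> f a + c / 2 * (norm a)^2 \<le> f z + c / 2 * (norm z)^2"
  shows "0 \<le> f b - f a + c * (a \<bullet> (b - a))"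
proof -
  let ?g = "\<lambda>t::real. f b - f a + c * (a \<bullet> (b - a)) + t * (c / 2 * (norm (b - a))^2)"
  have nonneg: "0 \<le> ?g t" if t: "0 < t" "t < 1" for t
  proof -
    let ?z = "(1 - t) *\<^sub>R a + t *\<^sub>R b"
    have "?z \<in> S"
      using convex_on_imp_convex[OF f] assms t by (simp add: convexD)
    then have "f a + c / 2 * (norm a)^2 \<le> f ?z + c / 2 * (norm ?z)^2"
      by (rule min)
    moreover have "f ?z \<le> (1 - t) * f a + t * f b"
      using convex_onD[OF f, of t a b] assms t by simp
    moreover have "c / 2 * (norm ?z)^2 =
        c / 2 * (norm a)^2 + t * (c * (a \<bullet> (b - a)) + t * (c / 2 * (norm (b - a))^2))"
    proof -
      have "(norm ?z)^2 =
          (norm a)^2 + 2 * t * (a \<bullet> (b - a)) + t^2 * (norm (b - a))^2"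
        unfolding power2_norm_eq_inner
        by (simp add: inner_simps inner_commute power2_eq_square algebra_simps)
      then show ?thesis
        by (simp only:) (simp add: power2_eq_square distrib_left)
    qed
    ultimately have "0 \<le> (1 - t) * f a + t * f b - f a +
        t * (c * (a \<bullet> (b - a)) + t * (c / 2 * (norm (b - a))^2))"
      by linarith
    also have "\<dots> = t * ?g t"
      by (simp add: algebra_simps)
    finally have "0 \<le> t * ?g t" .
    then show ?thesis
      using t by (simp add: zero_le_mult_iff)
  qed
  \<comment> \<open>The increment bound has been divided by \<open>t\<close>; letting
    \<open>t\<close> tend to 0 from the right removes the second-order remainder.\<close>
  have "(?g \<longlongrightarrow> f b - f a + c * (a \<bullet> (b - a)) + 0 * (c / 2 * (norm (b - a))^2)) (at_right 0)"
    by (intro tendsto_intros)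
  moreover have "\<forall>\<^sub>F t in at_right 0. 0 \<le> ?g t"
    using nonneg by (intro eventually_at_rightI[of 0 1]) auto
  ultimately show ?thesis
    using tendsto_lowerbound[of ?g _ "at_right (0::real)" 0] by simp
qed

text \<open>Each minimiser is tested against the other one. The ball is stated scaled by
  \<open>2 * lam\<close>, which avoids division.\<close>

lemma regularization_path_ball:
  fixes f :: "'a::real_inner \<Rightarrow> real"
  assumes f: "convex_on S f" and "a \<in> S" "b \<in> S" and "lam > 0"
    and min_a: "\<And>z. z \<in> S \<Longrightarrow> f a + lam0 / 2 * (norm a)^2 \<le> f z + lam0 / 2 * (norm z)^2"
    and min_b: "\<And>z. z \<in> S \<Longrightarrow> f b + lam / 2 * (norm b)^2 \<le> f z + lam / 2 * (norm z)^2"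
  shows "norm ((2 * lam) *\<^sub>R b - (lam0 + lam) *\<^sub>R a) \<le> \<bar>lam0 - lam\<bar> * norm a"
proof -
  have "0 \<le> f b - f a + lam0 * (a \<bullet> (b - a))"
    using f assms(2,3) min_a by (rule regularized_minimizer_variational)
  moreover have "0 \<le> f a - f b + lam * (b \<bullet> (a - b))"
    using f assms(3,2) min_b by (rule regularized_minimizer_variational)
  ultimately have "0 \<le> lam0 * (a \<bullet> (b - a)) + lam * (b \<bullet> (a - b))"
    by simp
  \<comment> \<open>The factor \<open>4 * lam\<close> completes the square in \<open>b\<close>; the
    remaining coefficient of the squared norm of \<open>a\<close> is
    \<open>(lam0 + lam)^2 - 4 * lam * lam0 = (lam0 - lam)^2\<close>.\<close>
  then have "0 \<le> 4 * lam * (lam0 * (a \<bullet> (b - a)) + lam * (b \<bullet> (a - b)))"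
    using \<open>lam > 0\<close> by simp
  also have "\<dots> = (\<bar>lam0 - lam\<bar> * norm a)^2 - (norm ((2 * lam) *\<^sub>R b - (lam0 + lam) *\<^sub>R a))^2"
    unfolding power_mult_distrib power2_norm_eq_inner power2_abs
    by (simp add: inner_simps inner_commute power2_eq_square algebra_simps)
  finally have "(norm ((2 * lam) *\<^sub>R b - (lam0 + lam) *\<^sub>R a))^2 \<le> (\<bar>lam0 - lam\<bar> * norm a)^2"
    by simp
  then show ?thesis
    by (rule power2_le_imp_le) simp
qed

lemma optimal_solution_path_ball:
  assumes "\<gamma> \<ge> 0" and "lam > 0"
    and "optimal_solution n x y \<gamma> lam0 A" and "optimal_solution n x y \<gamma> lam B"
  shows "norm ((2 * lam) *\<^sub>R B - (lam0 + lam) *\<^sub>R A) \<le> \<bar>lam0 - lam\<bar> * norm A"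
proof (rule regularization_path_ball)
  show "convex_on {M. psd M} (\<lambda>M. \<Sum>t\<in>triplets n y. loss \<gamma> (mat_ip M (triplet_mat x t)))"
    using convex_on_subset[OF convex_on_sum_loss[OF assms(1)]] convex_psd by blast
qed (use assms in \<open>auto simp: optimal_solution_def is_arg_min_linorder primal_def fro_norm_eq_norm\<close>)

section \<open>The screening interval\<close>

theorem theorem4p1:
  fixes n :: nat and x :: "nat \<Rightarrow> real^'d" and y :: "nat \<Rightarrow> 'c"
    and \<gamma> lam0 \<epsilon> :: real and M0star M0 :: "real^'d^'d" and i j l :: nat
  assumes "\<gamma> \<ge> 0" and "lam0 > 0" and "\<epsilon> \<ge> 0"
    and "optimal_solution n x y \<gamma> lam0 M0star"
    and "fro_norm (M0star - M0) \<le> \<epsilon>"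
    and "(i, j, l) \<in> triplets n y"
    and "mat_ip (triplet_mat x (i, j, l)) M0 - 2
           + fro_norm (triplet_mat x (i, j, l)) * fro_norm M0 > 0"
  shows "\<forall>lam \<in> {lambda_a lam0 \<epsilon> M0 (triplet_mat x (i, j, l))
                  <..< lambda_b lam0 \<epsilon> M0 (triplet_mat x (i, j, l))}.
           \<forall>Mstar. optimal_solution n x y \<gamma> lam Mstar \<longrightarrow> (i, j, l) \<in> R_set n x y Mstar"
proof (intro ballI allI impI)
  fix lam Mstar
  define H where "H = triplet_mat x (i, j, l)"
  define p where "p = norm H * norm M0"
  define q where "q = H \<bullet> M0"
  define e where "e = \<epsilon> * norm H"
  assume "lam \<in> {lambda_a lam0 \<epsilon> M0 (triplet_mat x (i, j, l))
                  <..< lambda_b lam0 \<epsilon> M0 (triplet_mat x (i, j, l))}"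
    and opt: "optimal_solution n x y \<gamma> lam Mstar"
  then have la: "lam0 * (p - q + 2 * e) / (q - 2 + p) < lam"
    and lb: "lam < lam0 * (p + q) / (p - q + 2 + 2 * e)"
    by (simp_all add: lambda_a_def lambda_b_def fro_norm_eq_norm mat_ip_eq_inner
        H_def[symmetric] p_def q_def e_def ac_simps)
  have den: "q - 2 + p > 0"
    using assms(7) by (simp add: fro_norm_eq_norm mat_ip_eq_inner H_def[symmetric] p_def q_def)
  have e: "e \<ge> 0"
    using assms(3) by (simp add: e_def)
  have qp: "q \<le> p"
    unfolding p_def q_def by (rule norm_cauchy_schwarz)
  \<comment> \<open>Positivity of \<open>lam\<close> comes from the interval itself: its left end is
    nonnegative by Cauchy-Schwarz.\<close>
  have "0 \<le> lam0 * (p - q + 2 * e) / (q - 2 + p)"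
    using e qp den assms(2) by simp
  then have lam: "lam > 0"
    using la by simp
  have la': "lam0 * (p - q + 2 * e) < lam * (q - 2 + p)"
    using la den by (simp add: pos_divide_less_eq)
  have lb': "lam * (p - q + 2 + 2 * e) < lam0 * (p + q)"
    using lb e qp by (simp add: pos_less_divide_eq)
  have dist: "norm (M0star - M0) \<le> \<epsilon>"
    using assms(5) by (simp add: fro_norm_eq_norm)
  \<comment> \<open>Passing from \<open>M0star\<close> to \<open>M0\<close> costs at most
    \<open>e\<close> in the inner product with \<open>H\<close>, and at most \<open>e\<close> in the
    product of norms.\<close>
  have "\<bar>H \<bullet> (M0star - M0)\<bar> \<le> norm H * norm (M0star - M0)"
    by (rule Cauchy_Schwarz_ineq2)
  also have "\<dots> \<le> e"
    using mult_left_mono[OF dist, of "norm H"] by (simp add: e_def mult.commute)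
  finally have q': "q - e \<le> H \<bullet> M0star"
    by (simp add: q_def inner_diff_right)
  have "norm M0star \<le> norm M0 + \<epsilon>"
    using dist norm_triangle_sub[of M0star M0] by simp
  then have p': "norm H * norm M0star \<le> p + e"
    using mult_left_mono[of "norm M0star" "norm M0 + \<epsilon>" "norm H"]
    by (simp add: p_def e_def algebra_simps)
  have "\<bar>H \<bullet> ((2 * lam) *\<^sub>R Mstar - (lam0 + lam) *\<^sub>R M0star)\<bar> \<le>
      norm H * norm ((2 * lam) *\<^sub>R Mstar - (lam0 + lam) *\<^sub>R M0star)"
    by (rule Cauchy_Schwarz_ineq2)
  also have "\<dots> \<le> norm H * (\<bar>lam0 - lam\<bar> * norm M0star)"
    using optimal_solution_path_ball[OF assms(1) lam assms(4) opt] by (rule mult_left_mono) simp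
  also have "\<dots> = \<bar>lam0 - lam\<bar> * (norm H * norm M0star)"
    by simp
  also have "\<dots> \<le> \<bar>lam0 - lam\<bar> * (p + e)"
    using p' by (rule mult_left_mono) simp
  finally have "(lam0 + lam) * (H \<bullet> M0star) - \<bar>lam0 - lam\<bar> * (p + e) \<le> 2 * lam * (H \<bullet> Mstar)"
    by (simp add: inner_diff_right)
  moreover have "(lam0 + lam) * (q - e) \<le> (lam0 + lam) * (H \<bullet> M0star)"
    using q' assms(2) lam by (intro mult_left_mono) auto
  ultimately have "(lam0 + lam) * (q - e) - \<bar>lam0 - lam\<bar> * (p + e) \<le> 2 * lam * (H \<bullet> Mstar)"
    by linarith
  \<comment> \<open>For \<open>lam \<le> lam0\<close> the right side is
    \<open>lam * (p + q) - lam0 * (p - q + 2 * e)\<close>, so the claim is \<open>la'\<close>;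
    otherwise it is \<open>lam0 * (p + q) - lam * (p - q + 2 * e)\<close>, and the claim is
    \<open>lb'\<close>. In both cases the errors \<open>e\<close> cancel next to
    \<open>p + q\<close> and double next to \<open>p - q\<close>.\<close>
  moreover have "2 * lam < (lam0 + lam) * (q - e) - \<bar>lam0 - lam\<bar> * (p + e)"
    using la' lb' by (cases "lam \<le> lam0") (simp_all add: algebra_simps)
  ultimately have "2 * lam * 1 < 2 * lam * (H \<bullet> Mstar)"
    by linarith
  then have "1 < H \<bullet> Mstar"
    using lam by (simp only: mult_less_cancel_left_pos)
  then show "(i, j, l) \<in> R_set n x y Mstar"
    using assms(6) by (simp add: R_set_def mat_ip_eq_inner H_def)
qed

end
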